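(* There exists a convergent sequence $\mathcal{K}\subset\mathbb{R}$ which is not the attractor of any iterated function system in $\mathbb{R}$ consisting of weak contractions. That is, there exists a convergent sequence $(x_n)_{n\in\mathbb{N}}$ of real numbers such that, for $\mathcal{K}=\overline{\{x_n : n\in\mathbb{N}\}}$, there is no finite family $f_1,\dots,f_r$ of weak contractions of $\mathbb{R}$ with $\mathcal{K}=\bigcup_{i=1}^r f_i(\mathcal{K})$.
   Context: $\mathbb{R}$ carries the usual distance $d$. A map $f:X\to X$ on a metric space $(X,d)$ is a weak contraction if $d(f(x),f(y))<d(x,y)$ for all $x,y\in X$ with $x\neq y$. An iterated function system (IFS) is a finite nonempty family of maps $f_1,\dots,f_r$; a compact set $\mathcal{K}$ is its attractor if $\mathcal{K}=\bigcup_{i=1}^r f_i(\mathcal{K})$. A sequence $\{x_n\}_{n\in\mathbb{N}}$ of reals, considered as a possible attractor, is identified with the closure $\overline{\{x_n : n\in\mathbb{N}\}}$. *)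

theory Defs
  imports "HOL-Analysis.Analysis"
begin

definition weak_contraction :: "('a::metric_space \<Rightarrow> 'a) \<Rightarrow> bool" where
  "weak_contraction f \<longleftrightarrow> (\<forall>x y. x \<noteq> y \<longrightarrow> dist (f x) (f y) < dist x y)"

text \<open>
  An iterated function system is a nonempty list of self-maps of the whole space.
  Its attractors are not required to be unique: any compact set that is invariant counts as one.
\<close>

definition is_ifs :: "('a::metric_space \<Rightarrow> 'a) list \<Rightarrow> bool" where
  "is_ifs fs \<longleftrightarrow> fs \<noteq> []"

definition is_attractor :: "'a::metric_space set \<Rightarrow> ('a \<Rightarrow> 'a) list \<Rightarrow> bool" where
  "is_attractor K fs \<longleftrightarrow> compact K \<and> K = (\<Union>f\<in>set fs. f ` K)"

end

theory Submission
  imports Defs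
begin

text \<open>
  Take a sequence decreasing to \<open>0\<close> whose successive gaps never increase and stay constant along
  very long blocks: here the indices from \<open>k!\<close> to \<open>(k+1)! - 1\<close> form the \<open>k\<close>-th block.  Let \<open>K\<close> be
  its closure and let \<open>f\<close> be a weak contraction mapping \<open>K\<close> into itself.  The claim is that \<open>f\<close>
  hits at most \<open>k! + 1\<close> points of the \<open>k\<close>-th block, for all large \<open>k\<close>
  (\<open>shrinking_gaps.eventually_card_hits_le\<close>).

  If \<open>f\<close> moves \<open>0\<close>, then it moves it to an isolated point of \<open>K\<close>, so \<open>f\<close> is constant near \<open>0\<close> and
  its image is finite.  If \<open>f\<close> fixes \<open>0\<close>, it brings every point closer to \<open>0\<close>, so a point of the
  block can only come from the \<open>k!\<close> points preceding the block or from the block itself.  The block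
  itself contributes at most one point: neighbours in the block are one gap apart, their images are
  strictly less than one gap apart, and a point of the block has no other point of \<open>K\<close> so
  close to it; hence as soon as one point of the block stays in the block, the later ones have the
  same image.

  Since the \<open>k\<close>-th block has \<open>k \<cdot> k!\<close> points, \<open>r\<close> maps hitting at most \<open>k! + 1 \<le> 2 k!\<close> of them each
  cannot cover it when \<open>k > 2 r\<close>.  So no finite family can have \<open>K\<close> as its attractor.
\<close>

section \<open>Weak contractions on a sequence with shrinking gaps\<close>

locale shrinking_gaps =
  fixes x :: "nat \<Rightarrow> real"
  assumes tendsto_zero: "x \<longlonglongrightarrow> 0"
    and gap_pos: "x n - x (Suc n) > 0"
    and gap_antimono: "m \<le> n \<Longrightarrow> x n - x (Suc n) \<le> x m - x (Suc m)"
begin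

lemma strictly_decreasing: "m < n \<Longrightarrow> x n < x m"
  using lift_Suc_mono_less[of "\<lambda>n. - x n" m n] gap_pos by simp

lemma decreasing: "m \<le> n \<Longrightarrow> x n \<le> x m"
  using strictly_decreasing[of m n] by (cases "m = n") auto

lemma pos: "x n > 0"
proof -
  have "x (Suc n) \<ge> 0"
    using decseq_ge[OF _ tendsto_zero] decreasing by (simp add: decseq_def)
  then show ?thesis
    using gap_pos[of n] by linarith
qed

lemma inj: "inj x"
  by (rule linorder_injI) (use strictly_decreasing in force)

lemma closure_range: "closure (range x) = insert 0 (range x)"
proof
  have "closed (insert 0 (range x))"
    using compact_sequence_with_limit[OF tendsto_zero] by (rule compact_imp_closed)
  then show "closure (range x) \<subseteq> insert 0 (range x)"
    by (rule closure_minimal[OF subset_insertI])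
  have "0 \<in> closure (range x)"
    unfolding closure_sequential using tendsto_zero by (intro exI[of _ x]) simp
  then show "insert 0 (range x) \<subseteq> closure (range x)"
    using closure_subset[of "range x"] by blast
qed

text \<open>
  As the gaps never increase, the gap below a point is a lower bound for its distance to the whole
  rest of the closure, not only to the points below it.
\<close>

lemma isolated_by_gap:
  assumes "y \<in> insert 0 (range x)" and close: "\<bar>y - x m\<bar> < x m - x (Suc m)"
  shows "y = x m"
proof (rule ccontr)
  assume "y \<noteq> x m"
  then consider "y = 0" | j where "y = x j" "m < j" | j where "y = x j" "j < m"
    using assms(1) by (metis imageE insertE linorder_neqE_nat)
  then show False
  proof cases
    case 1
    then show ?thesis using close pos[of "Suc m"] by linarith
  next
    case 2
    then show ?thesis using close decreasing[of "Suc m" j] by simp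
  next
    case 3
    then show ?thesis
      using close decreasing[of "Suc j" m] gap_antimono[of j m] by simp
  qed
qed

text \<open>
  A block of equally spaced points is rigid: it cannot be compressed into itself without
  collapsing, because neighbours would have to land less than one gap apart.
\<close>

lemma block_collapses:
  assumes f: "weak_contraction f" "f ` insert 0 (range x) \<subseteq> insert 0 (range x)"
    and gaps: "\<And>n. n \<in> {a..<b} \<Longrightarrow> x n - x (Suc n) = c"
    and n: "n \<in> {a..<b}" "f (x n) \<in> x ` {a..<b}"
    and "n \<le> n'" "n' < b"
  shows "f (x n') = f (x n)"
  using \<open>n \<le> n'\<close> \<open>n' < b\<close>
proof (induction n' rule: dec_induct)
  case base
  show ?case by simp
next
  case (step i)
  then have eq: "f (x i) = f (x n)" by simp
  obtain m where m: "m \<in> {a..<b}" "f (x n) = x m"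
    using n by blast
  have "x (Suc i) \<noteq> x i"
    using gap_pos[of i] by auto
  then have "dist (f (x (Suc i))) (f (x i)) < dist (x (Suc i)) (x i)"
    using f unfolding weak_contraction_def by blast
  also have "\<dots> = x i - x (Suc i)"
    using gap_pos[of i] by (simp add: dist_real_def)
  also have "\<dots> = x m - x (Suc m)"
    using gaps[of i] gaps[of m] m n step by simp
  finally have "\<bar>f (x (Suc i)) - x m\<bar> < x m - x (Suc m)"
    by (simp add: eq m dist_real_def)
  moreover have "f (x (Suc i)) \<in> insert 0 (range x)"
    using f(2) by blast
  ultimately show ?case
    using isolated_by_gap m by metis
qed

lemma card_block_to_itself_le:
  assumes "weak_contraction f" "f ` insert 0 (range x) \<subseteq> insert 0 (range x)"
    and "\<And>n. n \<in> {a..<b} \<Longrightarrow> x n - x (Suc n) = c"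
  shows "card (f ` x ` {a..<b} \<inter> x ` {a..<b}) \<le> 1"
proof -
  have same: "u = v" if uv: "u \<in> f ` x ` {a..<b} \<inter> x ` {a..<b}" "v \<in> f ` x ` {a..<b} \<inter> x ` {a..<b}" for u v
  proof -
    obtain n where n: "n \<in> {a..<b}" "u = f (x n)" "f (x n) \<in> x ` {a..<b}"
      using uv by blast
    obtain n' where n': "n' \<in> {a..<b}" "v = f (x n')" "f (x n') \<in> x ` {a..<b}"
      using uv by blast
    show ?thesis
      using block_collapses[OF assms n(1,3), of n'] block_collapses[OF assms n'(1,3), of n] n n'
      by (cases "n \<le> n'") auto
  qed
  have "finite (f ` x ` {a..<b} \<inter> x ` {a..<b})"
    by simp
  then have "card (f ` x ` {a..<b} \<inter> x ` {a..<b}) \<le> Suc 0"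
    by (subst card_le_Suc0_iff_eq) (blast intro: same)+
  then show ?thesis by simp
qed

text \<open>
  With \<open>0\<close> fixed, every point moves closer to \<open>0\<close>, so nothing beyond the block reaches it: its
  points come from the \<open>a\<close> earlier ones, plus at most one from the block itself.
\<close>

lemma card_image_fixing_zero_le:
  assumes f: "weak_contraction f" "f ` insert 0 (range x) \<subseteq> insert 0 (range x)" and "f 0 = 0"
    and gaps: "\<And>n. n \<in> {a..<b} \<Longrightarrow> x n - x (Suc n) = c"
  shows "card (f ` insert 0 (range x) \<inter> x ` {a..<b}) \<le> a + 1"
proof -
  have lower: "f (x m) < x m" for m
  proof -
    have "dist (f (x m)) (f 0) < dist (x m) 0"
      using f(1) pos[of m] unfolding weak_contraction_def by (metis less_irrefl)
    then show ?thesis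
      using pos[of m] \<open>f 0 = 0\<close> by (simp add: dist_real_def)
  qed
  have "f ` insert 0 (range x) \<inter> x ` {a..<b}
      \<subseteq> f ` x ` {..<a} \<union> (f ` x ` {a..<b} \<inter> x ` {a..<b})"
  proof
    fix y assume y: "y \<in> f ` insert 0 (range x) \<inter> x ` {a..<b}"
    then obtain j where j: "j \<in> {a..<b}" "y = x j" by blast
    then have "y \<noteq> 0" using pos[of j] by simp
    then obtain m where m: "y = f (x m)" using y \<open>f 0 = 0\<close> by auto
    have "m < b"
    proof (rule ccontr)
      assume "\<not> m < b"
      then have "x m \<le> x j" using j by (intro decreasing) auto
      then show False using lower[of m] m j by simp
    qed
    then show "y \<in> f ` x ` {..<a} \<union> (f ` x ` {a..<b} \<inter> x ` {a..<b})"
      using m y by (cases "m < a") auto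
  qed
  then have "card (f ` insert 0 (range x) \<inter> x ` {a..<b})
      \<le> card (f ` x ` {..<a} \<union> (f ` x ` {a..<b} \<inter> x ` {a..<b}))"
    by (intro card_mono) auto
  also have "\<dots> \<le> card (f ` x ` {..<a}) + card (f ` x ` {a..<b} \<inter> x ` {a..<b})"
    by (rule card_Un_le)
  also have "\<dots> \<le> a + 1"
  proof (rule add_mono)
    show "card (f ` x ` {..<a}) \<le> a"
      using card_image_le[of "{..<a}" "\<lambda>n. f (x n)"] by (simp add: image_image)
  qed (rule card_block_to_itself_le[OF f gaps])
  finally show ?thesis .
qed

text \<open>
  If \<open>0\<close> moves to a point of the sequence, that point is isolated, so every point close enough
  to \<open>0\<close> must follow it: closer than the gap below the image is enough.
\<close>

lemma finite_image_moving_zero: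
  assumes f: "weak_contraction f" "f ` insert 0 (range x) \<subseteq> insert 0 (range x)" and "f 0 \<noteq> 0"
  shows "finite (f ` insert 0 (range x))"
proof -
  obtain p where p: "f 0 = x p"
    using f(2) \<open>f 0 \<noteq> 0\<close> by auto
  have "\<forall>\<^sub>F m in sequentially. x m < x p - x (Suc p)"
    using tendsto_zero gap_pos by (rule order_tendstoD(2))
  then obtain M where M: "\<And>m. m \<ge> M \<Longrightarrow> x m < x p - x (Suc p)"
    by (auto simp: eventually_sequentially)
  have const: "f (x m) = x p" if "m \<ge> M" for m
  proof (rule isolated_by_gap)
    show "f (x m) \<in> insert 0 (range x)" using f(2) by blast
    have "dist (f (x m)) (f 0) < dist (x m) 0"
      using f(1) pos[of m] unfolding weak_contraction_def by (metis less_irrefl)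
    then show "\<bar>f (x m) - x p\<bar> < x p - x (Suc p)"
      using M[OF that] pos[of m] p by (simp add: dist_real_def)
  qed
  have "f ` insert 0 (range x) \<subseteq> insert (x p) ((\<lambda>n. f (x n)) ` {..<M})"
  proof
    fix y assume "y \<in> f ` insert 0 (range x)"
    then consider "y = x p" | m where "y = f (x m)" using p by auto
    then show "y \<in> insert (x p) ((\<lambda>n. f (x n)) ` {..<M})"
      using const by cases (auto, metis imageI lessThan_iff not_le)
  qed
  then show ?thesis
    by (rule finite_subset) simp
qed

lemma eventually_card_hits_le:
  assumes f: "weak_contraction f" "f ` insert 0 (range x) \<subseteq> insert 0 (range x)"
    and block: "\<And>k n. n \<in> {a k..<b k} \<Longrightarrow> x n - x (Suc n) = c k"
    and a: "filterlim a at_top sequentially"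
  shows "\<forall>\<^sub>F k in sequentially. card (f ` insert 0 (range x) \<inter> x ` {a k..<b k}) \<le> a k + 1"
proof (cases "f 0 = 0")
  case True
  then show ?thesis
    using card_image_fixing_zero_le[OF f True block] by (intro always_eventually) blast
next
  case False
  have "\<forall>\<^sub>F k in sequentially. card (f ` insert 0 (range x)) \<le> a k"
    using a by (simp add: filterlim_at_top)
  then show ?thesis
  proof eventually_elim
    case (elim k)
    have "card (f ` insert 0 (range x) \<inter> x ` {a k..<b k}) \<le> card (f ` insert 0 (range x))"
      using finite_image_moving_zero[OF f False] by (intro card_mono) auto
    then show ?case using elim by linarith
  qed
qed

theorem not_attractor:
  assumes weak: "\<forall>f\<in>set fs. weak_contraction f"
    and block: "\<And>k n. n \<in> {fact k..<fact (Suc k)} \<Longrightarrow> x n - x (Suc n) = c k"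
  shows "\<not> is_attractor (closure (range x)) fs"
proof
  assume "is_attractor (closure (range x)) fs"
  moreover define K where "K = insert 0 (range x)"
  ultimately have cover: "(\<Union>f\<in>set fs. f ` K) = K"
    by (simp only: is_attractor_def closure_range)
  have invariant: "f ` K \<subseteq> K" if "f \<in> set fs" for f
    using UN_upper[OF that, of "\<lambda>f. f ` K"] unfolding cover .
  define B where "B k = x ` {fact k..<fact (Suc k)}" for k :: nat
  define r where "r = card (set fs)"
  have fact_at_top: "filterlim (fact :: nat \<Rightarrow> nat) at_top sequentially"
    by (rule filterlim_at_top_mono[OF filterlim_ident]) (simp add: fact_ge_self)
  have "\<forall>\<^sub>F k in sequentially. card (f ` K \<inter> B k) \<le> fact k + 1" if "f \<in> set fs" for f
    unfolding K_def B_def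
  proof (rule eventually_card_hits_le[OF _ _ block fact_at_top])
    show "weak_contraction f" using weak that by blast
    show "f ` insert 0 (range x) \<subseteq> insert 0 (range x)" using invariant[OF that] by (simp only: K_def)
  qed
  then have "\<forall>\<^sub>F k in sequentially. \<forall>f\<in>set fs. card (f ` K \<inter> B k) \<le> fact k + 1"
    by (intro eventually_ball_finite ballI finite_set)
  then have "\<forall>\<^sub>F k in sequentially. (\<forall>f\<in>set fs. card (f ` K \<inter> B k) \<le> fact k + 1) \<and> 2 * r < k"
    using eventually_gt_at_top by (rule eventually_conj)
  from eventually_happens'[OF sequentially_bot this]
  obtain k where k: "\<And>f. f \<in> set fs \<Longrightarrow> card (f ` K \<inter> B k) \<le> fact k + 1" "2 * r < k"
    by blast
  have "k * fact k = card (B k)"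
    unfolding B_def using inj by (simp add: card_image inj_on_subset)
  also have "B k = (\<Union>f\<in>set fs. f ` K \<inter> B k)"
  proof -
    have "B k \<subseteq> (\<Union>f\<in>set fs. f ` K)"
      unfolding cover by (auto simp: K_def B_def)
    then show ?thesis by blast
  qed
  also have "card \<dots> \<le> (\<Sum>f\<in>set fs. card (f ` K \<inter> B k))"
    by (rule card_UN_le) simp
  also have "\<dots> \<le> r * (fact k + 1)"
    using sum_bounded_above[of "set fs" "\<lambda>f. card (f ` K \<inter> B k)" "fact k + 1"] k
    by (simp add: r_def)
  also have "\<dots> \<le> r * (2 * fact k)"
    using fact_ge_1[of k, where ?'a = nat] by (intro mult_left_mono) auto
  also have "\<dots> < k * fact k"
    using k(2) by simp
  finally show False by simp
qed

end

section \<open>A sequence with constant gaps between factorials\<close>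

definition next_fact :: "nat \<Rightarrow> nat" where
  "next_fact n = fact (LEAST k. n < fact k)"

lemma less_next_fact: "n < next_fact n"
proof -
  have "n < fact (Suc n)"
    using fact_ge_self[of "Suc n"] by linarith
  then show ?thesis
    unfolding next_fact_def by (rule LeastI)
qed

lemma next_fact_mono: "m \<le> n \<Longrightarrow> next_fact m \<le> next_fact n"
proof -
  assume "m \<le> n"
  then have "m < fact (LEAST k. n < fact k)"
    using less_next_fact[of n] by (simp add: next_fact_def)
  then show ?thesis
    unfolding next_fact_def by (intro fact_mono Least_le)
qed

lemma next_fact_eq: "n \<in> {fact k..<fact (Suc k)} \<Longrightarrow> next_fact n = fact (Suc k)"
  unfolding next_fact_def
proof (rule arg_cong[where f = fact], rule Least_equality)
  fix j assume "n \<in> {fact k..<fact (Suc k)}" "n < fact j"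
  then have "fact k < (fact j :: nat)" by auto
  then show "Suc k \<le> j"
    using fact_mono[of j k, where ?'a = nat] by (meson leD not_less_eq_eq)
qed simp

text \<open>
  The gap at \<open>n\<close> is the inverse square of the first factorial above \<open>n\<close>.  This is constant between
  factorials, and summable because it lies below the inverse square of \<open>n + 1\<close>.
\<close>

definition gap :: "nat \<Rightarrow> real" where
  "gap n = 1 / real (next_fact n) ^ 2"

lemma gap_pos: "gap n > 0"
  using less_next_fact[of n] by (simp add: gap_def)

lemma gap_antimono: "m \<le> n \<Longrightarrow> gap n \<le> gap m"
  unfolding gap_def using next_fact_mono[of m n] less_next_fact[of m] less_next_fact[of n]
  by (intro divide_left_mono power_mono mult_pos_pos) auto

lemma summable_gap: "summable gap"
proof (rule summable_comparison_test')
  show "summable (\<lambda>n. 1 / real (n + 1) ^ 2)"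
    using inverse_power_summable[of 2, where ?'a = real]
      summable_iff_shift[of "\<lambda>n. inverse (real n ^ 2)" 1]
    by (simp add: inverse_eq_divide)
  show "norm (gap n) \<le> 1 / real (n + 1) ^ 2" if "n \<ge> 0" for n
    unfolding gap_def using less_next_fact[of n] by (auto intro!: divide_left_mono power_mono)
qed

text \<open>The sum of the gaps from \<open>n\<close> on; a difference makes the successive gaps immediate.\<close>

definition gap_tail :: "nat \<Rightarrow> real" where
  "gap_tail n = suminf gap - sum gap {..<n}"

lemma gap_tail_diff: "gap_tail n - gap_tail (Suc n) = gap n"
  by (simp add: gap_tail_def)

interpretation gap_tail: shrinking_gaps gap_tail
proof
  show "gap_tail \<longlonglongrightarrow> 0"
    unfolding gap_tail_def
    using tendsto_diff[OF tendsto_const summable_LIMSEQ[OF summable_gap], of "suminf gap"] by simp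
  show "gap_tail n - gap_tail (Suc n) > 0" for n
    unfolding gap_tail_diff by (rule gap_pos)
  show "gap_tail n - gap_tail (Suc n) \<le> gap_tail m - gap_tail (Suc m)" if "m \<le> n" for m n
    unfolding gap_tail_diff using that by (rule gap_antimono)
qed

theorem theorem1:
  "\<exists>x :: nat \<Rightarrow> real. convergent x \<and>
     (\<nexists>fs :: (real \<Rightarrow> real) list.
        is_ifs fs \<and> (\<forall>f\<in>set fs. weak_contraction f) \<and> is_attractor (closure (range x)) fs)"
proof (intro exI conjI notI)
  show "convergent gap_tail"
    using gap_tail.tendsto_zero by (rule convergentI)
next
  assume "\<exists>fs :: (real \<Rightarrow> real) list.
    is_ifs fs \<and> (\<forall>f\<in>set fs. weak_contraction f) \<and> is_attractor (closure (range gap_tail)) fs"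
  then obtain fs :: "(real \<Rightarrow> real) list" where
    fs: "\<forall>f\<in>set fs. weak_contraction f" "is_attractor (closure (range gap_tail)) fs"
    by blast
  have "gap_tail n - gap_tail (Suc n) = 1 / real (fact (Suc k)) ^ 2"
    if "n \<in> {fact k..<fact (Suc k)}" for k n
    by (simp only: gap_tail_diff gap_def next_fact_eq[OF that])
  then show False
    using gap_tail.not_attractor[OF fs(1), of "\<lambda>k. 1 / real (fact (Suc k)) ^ 2"] fs(2) by blast
qed

end
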